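(* Let $N$ be a non-negative integer, $k$ any integer, and $\nu\in\{0,1\}$. Then \[ \widetilde{B}_{2N+\nu}(k,q)= \frac{q^{2k^2-k}}{(q^2;q^2)_{N+k}\,(q^2;q^2)_{N-k+\nu}},\] where the right-hand side is interpreted as $0$ when $N+k<0$ or $N-k+\nu<0$.
   Context: A partition $\pi=(\lambda_1,\lambda_2,\dots)$ is a finite non-increasing sequence of positive integers (its parts); the empty sequence is the unique partition of $0$. The parts $\lambda_{2r-1}$ are odd-indexed and the parts $\lambda_{2r}$ even-indexed ($r\ge1$). The BG-rank of $\pi$ is $BG(\pi)=i-j$, where $i$ is the number of odd-indexed parts that are odd and $j$ is the number of even-indexed parts that are odd. $\widetilde B_N(k,q)$ is the generating function $\sum_\pi q^{|\pi|}$ over all partitions $\pi$ (parts may repeat) with all parts $\le N$ and $BG(\pi)=k$, where $|\pi|$ is the sum of the parts of $\pi$. Notation: $(a;q)_L=\prod_{n=0}^{L-1}(1-aq^n)$ for integers $L\ge0$. Identities are of formal power series in $q$ (or for $|q|<1$). *)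

theory Defs
  imports Complex_Main "HOL-Computational_Algebra.Formal_Power_Series"
begin

definition int_partition :: "nat list \<Rightarrow> bool" where
  "int_partition p \<longleftrightarrow> sorted_wrt (\<ge>) p \<and> (\<forall>x\<in>set p. x > 0)"

text \<open>List positions start at 0, so the part \<open>\<lambda>\<^sub>m\<close> of \<open>p\<close> is \<open>p ! (m - 1)\<close>:
  the odd-indexed parts are those at even list positions.\<close>

definition BG_rank :: "nat list \<Rightarrow> int" where
  "BG_rank p = int (card {i. i < length p \<and> even i \<and> odd (p ! i)})
             - int (card {i. i < length p \<and> odd i \<and> odd (p ! i)})"

definition BG_partitions :: "nat \<Rightarrow> int \<Rightarrow> nat \<Rightarrow> nat list set" where
  "BG_partitions N k n =
     {p. int_partition p \<and> (\<forall>x\<in>set p. x \<le> N) \<and> BG_rank p = k \<and> sum_list p = n}"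

text \<open>Finiteness ensures that \<open>card\<close> in the generating function below counts properly.\<close>

lemma finite_BG_partitions: "finite (BG_partitions N k n)"
proof (rule finite_subset)
  have len: "length p \<le> sum_list p" if "\<forall>x\<in>set p. x > 0" for p :: "nat list"
    using that by (induction p) auto
  show "BG_partitions N k n \<subseteq> {p. set p \<subseteq> {..N} \<and> length p \<le> n}"
    using len by (auto simp: BG_partitions_def int_partition_def)
  show "finite {p. set p \<subseteq> {..N} \<and> length p \<le> n}"
    by (rule finite_lists_length_le) simp
qed

definition BG_gf :: "nat \<Rightarrow> int \<Rightarrow> rat fps" where
  "BG_gf N k = Abs_fps (\<lambda>n. of_nat (card (BG_partitions N k n)))"

definition q_pochhammer :: "'a::comm_ring_1 \<Rightarrow> 'a \<Rightarrow> nat \<Rightarrow> 'a" where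
  "q_pochhammer a q L = (\<Prod>n<L. 1 - a * q ^ n)"

end

theory Submission imports Defs begin

text \<open>
  Classify the partitions into parts at most \<open>M\<close> by whether \<open>M\<close> occurs. Deleting a largest part
  \<open>M\<close> shifts all later indices by one, so it turns the rank \<open>k\<close> into \<open>[M odd] - k\<close>; hence
  \<open>B M k = B (M - 1) k + q\<^sup>M B M ([M odd] - k)\<close> for \<open>M > 0\<close>. This recurrence and the values at
  \<open>M = 0\<close> determine \<open>B\<close>. The product side satisfies the recurrence as well: the reflection
  \<open>k \<mapsto> [M odd] - k\<close> swaps the lengths \<open>\<lfloor>M/2\<rfloor> + k\<close> and \<open>\<lceil>M/2\<rceil> - k\<close> of the two \<open>q\<close>-factorials.
\<close>

lemma BG_rank_Nil [simp]: "BG_rank [] = 0"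
  by (simp add: BG_rank_def)

lemma BG_rank_Cons: "BG_rank (x # p) = of_bool (odd x) - BG_rank p"
proof -
  let ?A = "{i. i < length p \<and> odd i \<and> odd (p ! i)}"
  let ?B = "{i. i < length p \<and> even i \<and> odd (p ! i)}"
  have 1: "{i. i < length (x # p) \<and> even i \<and> odd ((x # p) ! i)}
      = (if odd x then {0} else {}) \<union> Suc ` ?A"
  proof (rule set_eqI)
    fix i
    show "i \<in> {i. i < length (x # p) \<and> even i \<and> odd ((x # p) ! i)} \<longleftrightarrow>
          i \<in> (if odd x then {0} else {}) \<union> Suc ` ?A"
      by (cases i) auto
  qed
  have 2: "{i. i < length (x # p) \<and> odd i \<and> odd ((x # p) ! i)} = Suc ` ?B"
  proof (rule set_eqI)
    fix i
    show "i \<in> {i. i < length (x # p) \<and> odd i \<and> odd ((x # p) ! i)} \<longleftrightarrow> i \<in> Suc ` ?B"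
      by (cases i) auto
  qed
  have "card ((if odd x then {0} else {}) \<union> Suc ` ?A) = of_bool (odd x) + card ?A"
    by (subst card_Un_disjoint) (auto simp: card_image)
  moreover have "card (Suc ` ?B) = card ?B"
    by (simp add: card_image)
  ultimately show ?thesis
    unfolding BG_rank_def 1 2 by simp
qed

lemma BG_partitions_0: "BG_partitions 0 k n = (if k = 0 \<and> n = 0 then {[]} else {})"
proof -
  have "p \<in> BG_partitions 0 k n \<longleftrightarrow> p = [] \<and> k = 0 \<and> n = 0" for p
    by (cases p) (auto simp: BG_partitions_def int_partition_def)
  then show ?thesis
    by auto
qed

lemma BG_partitions_rec:
  assumes "M > 0"
  shows "BG_partitions M k n = BG_partitions (M - 1) k n \<union>
    (if M \<le> n then Cons M ` BG_partitions M (of_bool (odd M) - k) (n - M) else {})"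
    (is "?L = ?R")
proof (rule set_eqI)
  fix p
  show "p \<in> ?L \<longleftrightarrow> p \<in> ?R"
  proof (cases p)
    case Nil
    then show ?thesis
      by (auto simp: BG_partitions_def int_partition_def)
  next
    case (Cons x ys)
    show ?thesis
    proof (cases "x = M")
      case True
      have "p \<notin> BG_partitions (M - 1) k n"
        using assms Cons True by (auto simp: BG_partitions_def)
      then show ?thesis
        using assms Cons True
        by (auto simp: BG_partitions_def int_partition_def BG_rank_Cons image_iff)
    next
      case False
      \<comment> \<open>The head \<open>x\<close> bounds all parts, so once it differs from
        \<open>M\<close> every part is at most \<open>M - 1\<close>.\<close>
      have "(\<forall>y\<in>set p. y \<le> M) \<longleftrightarrow> (\<forall>y\<in>set p. y \<le> M - 1)" if "int_partition p"
      proof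
        assume "\<forall>y\<in>set p. y \<le> M"
        then have "x \<le> M - 1"
          using Cons False by auto
        moreover have "\<forall>y\<in>set p. y \<le> x"
          using that Cons by (simp add: int_partition_def)
        ultimately show "\<forall>y\<in>set p. y \<le> M - 1"
          using order_trans by blast
      qed (auto intro: order_trans)
      moreover have "p \<notin> Cons M ` S" for S
        using Cons False by auto
      ultimately show ?thesis
        by (auto simp only: BG_partitions_def Un_iff mem_Collect_eq empty_iff split: if_splits)
    qed
  qed
qed

lemma card_BG_partitions_rec:
  assumes "M > 0"
  shows "card (BG_partitions M k n) = card (BG_partitions (M - 1) k n) +
    (if M \<le> n then card (BG_partitions M (of_bool (odd M) - k) (n - M)) else 0)"
proof -
  have "BG_partitions (M - 1) k n \<inter> Cons M ` S = {}" for S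
    using assms by (auto simp: BG_partitions_def)
  then show ?thesis
    by (subst BG_partitions_rec[OF assms])
       (simp add: card_Un_disjoint finite_BG_partitions card_image)
qed

lemma BG_gf_0: "BG_gf 0 k = (if k = 0 then 1 else 0)"
  by (rule fps_ext) (simp add: BG_gf_def BG_partitions_0)

lemma BG_gf_rec:
  assumes "M > 0"
  shows "BG_gf M k = BG_gf (M - 1) k + fps_X ^ M * BG_gf M (of_bool (odd M) - k)"
  by (rule fps_ext)
     (simp add: BG_gf_def fps_X_power_mult_nth card_BG_partitions_rec[OF assms, of k])

text \<open>The recurrence for \<open>F M\<close> refers to \<open>F M\<close> itself at another
  index, but the factor \<open>fps_X ^ M\<close> with \<open>M > 0\<close> lowers the coefficient
  position. So an induction on \<open>n\<close>, nested in the one on \<open>M\<close> and uniform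
  in \<open>k\<close>, settles each coefficient.\<close>

lemma fps_rec_unique:
  fixes F G :: "nat \<Rightarrow> 'b \<Rightarrow> 'a::comm_ring_1 fps" and s :: "nat \<Rightarrow> 'b \<Rightarrow> 'b"
  assumes "\<And>k. F 0 k = G 0 k"
    and "\<And>M k. M > 0 \<Longrightarrow> F M k = F (M - 1) k + fps_X ^ M * F M (s M k)"
    and "\<And>M k. M > 0 \<Longrightarrow> G M k = G (M - 1) k + fps_X ^ M * G M (s M k)"
  shows "F M k = G M k"
proof (induction M arbitrary: k)
  case 0
  show ?case by (rule assms(1))
next
  case (Suc M)
  have "fps_nth (F (Suc M) k) n = fps_nth (G (Suc M) k) n" for n
  proof (induction n arbitrary: k rule: less_induct)
    case (less n)
    show ?case
      by (subst assms(2), simp, subst assms(3), simp)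
         (simp add: fps_X_power_mult_nth less.IH Suc.IH del: power_Suc)
  qed
  then show ?case by (rule fps_ext)
qed

text \<open>The value 0 at negative lengths builds in the vanishing convention of the theorem and
  lets \<open>inv_q_fact_diff_1\<close> hold for every integer.\<close>

definition inv_q_fact :: "int \<Rightarrow> rat fps" where
  "inv_q_fact a = (if a < 0 then 0 else inverse (q_pochhammer (fps_X^2) (fps_X^2) (nat a)))"

lemma q_pochhammer_nth_0: "fps_nth (q_pochhammer (fps_X^2) (fps_X^2) L :: rat fps) 0 = 1"
  by (induction L) (simp_all add: q_pochhammer_def)

text \<open>For \<open>a > 0\<close> the last factor of the product cancels. For
  \<open>a \<le> 0\<close> the left side is 0, and so is the right, since
  \<open>nat (2 * a) = 0\<close> makes its first factor \<open>1 - 1\<close>.\<close>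

lemma inv_q_fact_diff_1: "inv_q_fact (a - 1) = (1 - fps_X ^ nat (2 * a)) * inv_q_fact a"
proof (cases "a > 0")
  case True
  let ?P = "q_pochhammer (fps_X^2) (fps_X^2) :: nat \<Rightarrow> rat fps"
  define m where "m = nat (a - 1)"
  have m: "nat a = Suc m" "nat (2 * a) = 2 + 2 * m"
    using True by (auto simp: m_def)
  let ?u = "1 - fps_X ^ (2 + 2 * m) :: rat fps"
  have "?P (Suc m) = ?P m * ?u"
    by (simp add: q_pochhammer_def power_add power_mult power2_eq_square)
  moreover have "?u * inverse ?u = 1"
    by (rule inverse_mult_eq_1') simp
  ultimately show ?thesis
    using True by (simp add: inv_q_fact_def m fps_inverse_mult m_def[symmetric])
next
  case False
  then show ?thesis
    by (cases "a = 0") (simp_all add: inv_q_fact_def)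
qed

text \<open>For \<open>M = 2 * N + \<nu>\<close> with \<open>\<nu>\<close> in \<open>{0, 1}\<close>,
  the two quotients are \<open>N\<close> and \<open>N + \<nu>\<close>, so one formula serves both
  parities.\<close>

definition BG_product :: "nat \<Rightarrow> int \<Rightarrow> rat fps" where
  "BG_product M k = fps_X ^ nat (2 * k^2 - k) *
     inv_q_fact (int (M div 2) + k) * inv_q_fact (int ((M + 1) div 2) - k)"

lemma BG_product_0: "BG_product 0 k = (if k = 0 then 1 else 0)"
  by (auto simp: BG_product_def inv_q_fact_def q_pochhammer_def)

text \<open>Keeps the exponents below from being truncated by \<open>nat\<close>.\<close>
lemma two_square_ge: "(k::int) \<le> 2 * k^2"
proof -
  have "k \<le> k^2"
    using self_le_power[of k 2] by (cases "k \<ge> 1") (auto intro: order_trans[of _ 0])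
  then show ?thesis
    using zero_le_power2[of k] by linarith
qed

lemma BG_product_rec:
  assumes "M > 0"
  shows "BG_product M k = BG_product (M - 1) k + fps_X ^ M * BG_product M (of_bool (odd M) - k)"
proof -
  define a b where "a = int (M div 2) + k" and "b = int ((M + 1) div 2) - k"
  define k' where "k' = of_bool (odd M) - k"
  let ?X = "fps_X :: rat fps" and ?e = "\<lambda>k::int. nat (2 * k^2 - k)"
  have G: "BG_product M k = ?X ^ ?e k * (inv_q_fact a * inv_q_fact b)"
    by (simp add: BG_product_def a_def b_def mult.assoc)
  have "int (M div 2) + k' = b" "int ((M + 1) div 2) - k' = a"
    by (auto simp: k'_def a_def b_def elim!: evenE oddE)
  then have G': "BG_product M k' = ?X ^ ?e k' * (inv_q_fact a * inv_q_fact b)"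
    by (simp add: BG_product_def mult_ac)
  \<comment> \<open>\<open>c\<close> is the length that drops by one on passing from
    \<open>M\<close> to \<open>M - 1\<close>; the other stays fixed.\<close>
  define c where "c = (if even M then a else b)"
  have G1: "BG_product (M - 1) k =
      ?X ^ ?e k * (1 - ?X ^ nat (2 * c)) * (inv_q_fact a * inv_q_fact b)"
  proof (cases "even M")
    case True
    then have "int ((M - 1) div 2) + k = a - 1" "int ((M - 1 + 1) div 2) - k = b"
      using assms by (auto simp: a_def b_def elim!: evenE)
    then show ?thesis
      using True by (simp add: BG_product_def inv_q_fact_diff_1 c_def mult_ac)
  next
    case False
    then have "int ((M - 1) div 2) + k = a" "int ((M - 1 + 1) div 2) - k = b - 1"
      by (auto simp: a_def b_def elim!: oddE)
    then show ?thesis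
      using False by (simp add: BG_product_def inv_q_fact_diff_1 c_def mult_ac)
  qed
  \<comment> \<open>All three terms of the recurrence share the factor
    \<open>inv_q_fact a * inv_q_fact b\<close>, so only powers of \<open>?X\<close> remain to be
    compared.\<close>
  have "?X ^ M * ?X ^ ?e k' * (inv_q_fact a * inv_q_fact b) =
      ?X ^ ?e k * ?X ^ nat (2 * c) * (inv_q_fact a * inv_q_fact b)"
  proof (cases "c \<ge> 0")
    case True
    have "int M + (2 * k'^2 - k') = (2 * k^2 - k) + 2 * c"
      by (cases "even M")
         (auto simp: c_def k'_def a_def b_def power2_eq_square algebra_simps elim!: evenE oddE)
    then have "M + ?e k' = ?e k + nat (2 * c)"
      using True two_square_ge[of k] two_square_ge[of k'] by linarith
    then show ?thesis
      by (simp flip: power_add)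
  next
    case False
    \<comment> \<open>Here \<open>nat (2 * c)\<close> truncates to 0 and the exponents need not
      agree, but the common factor vanishes.\<close>
    then have "inv_q_fact a * inv_q_fact b = 0"
      by (auto simp: c_def inv_q_fact_def split: if_splits)
    then show ?thesis by simp
  qed
  then show ?thesis
    unfolding k'_def[symmetric] G G' G1 by (simp add: right_diff_distrib left_diff_distrib mult.assoc)
qed

theorem theorem3p2:
  fixes N \<nu> :: nat and k :: int
  assumes "\<nu> \<in> {0, 1}"
  shows "BG_gf (2 * N + \<nu>) k =
    (if int N + k < 0 \<or> int N - k + int \<nu> < 0 then 0
     else fps_X ^ nat (2 * k^2 - k) /
       (q_pochhammer (fps_X^2) (fps_X^2) (nat (int N + k)) *
        q_pochhammer (fps_X^2) (fps_X^2) (nat (int N - k + int \<nu>))))"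
proof -
  have "BG_gf (2 * N + \<nu>) k = BG_product (2 * N + \<nu>) k"
  proof (rule fps_rec_unique[where F = BG_gf and G = BG_product
        and s = "\<lambda>M k. of_bool (odd M) - k"])
    show "BG_gf 0 k = BG_product 0 k" for k
      by (simp add: BG_gf_0 BG_product_0)
  qed (fact BG_gf_rec BG_product_rec)+
  also have "\<dots> = fps_X ^ nat (2 * k^2 - k) *
      (inv_q_fact (int N + k) * inv_q_fact (int N - k + int \<nu>))"
    using assms by (auto simp: BG_product_def algebra_simps)
  finally show ?thesis
    \<comment> \<open>Constant term 1 makes the denominators units, so the division is
      multiplication by inverses.\<close>
    by (simp add: inv_q_fact_def fps_divide_unit fps_inverse_mult q_pochhammer_nth_0)
qed

end
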